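(* Restricted to instances in which all projects have the same cost, both the weighted problem GreedyAV-CC\$DC (weighted constructive control by deleting candidates) and the weighted problem GreedyAV-DC\$DC (weighted destructive control by deleting candidates) can be solved in polynomial time, even if the projects' weights are encoded in binary.
   Context: A participatory budgeting (PB) instance is a triple $E=(P,V,B)$, where $P$ is a finite set of projects, $V$ is a finite set of voters and $B\in\mathbb{N}$ is the budget. Each voter $v\in V$ has an approval set $A(v)\subseteq P$, and each project $p\in P$ has a cost $\mathrm{cost}(p)\in\mathbb{N}_{\ge 1}$ with $\mathrm{cost}(p)\le B$. For $S\subseteq P$, $\mathrm{cost}(S)=\sum_{p\in S}\mathrm{cost}(p)$. A PB rule $f$ maps a PB instance $E$ to a set $f(E)\subseteq P$ with $\mathrm{cost}(f(E))\le B$; projects in $f(E)$ are called funded. Rules are resolute: ties are resolved by a given tie-breaking order (a linear order over the projects), which is given together with the instance and is restricted to the remaining projects when projects are deleted. GreedyAV: let $\mathrm{score}_{AV}(p)=|\{v\in V: p\in A(v)\}|$. Start with $W=\emptyset$ and process the projects in non-increasing order of $\mathrm{score}_{AV}$ (ties by the tie-breaking order). When project $p$ is processed, add it to $W$ if $\mathrm{cost}(W)+\mathrm{cost}(p)\le B$; otherwise skip it. Stop when all projects have been processed and output $W$. $f$-CC\$DC: given a PB instance $E=(P,V,B)$, a nonnegative integer weight $\omega(q)$ for every project $q$, a nonnegative integer $r$ and a project $p\in P$ with $p\notin f(E)$, decide whether there is a set $D\subseteq P\setminus\{p\}$ with $\sum_{q\in D}\omega(q)\le r$ such that $p\in f((P\setminus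 D,V,B))$ (approval sets are restricted to the remaining projects). $f$-DC\$DC: the same input except that $p\in f(E)$; decide whether there is a set $D\subseteq P\setminus\{p\}$ with $\sum_{q\in D}\omega(q)\le r$ such that $p\notin f((P\setminus D,V,B))$. *)

theory Defs
  imports "HOL-Library.Log_Nat" "HOL-Computational_Algebra.Polynomial"
begin

section \<open>Participatory budgeting\<close>

text \<open>
  The tie-breaking order is a duplicate-free list of all projects, earlier projects having
  priority. The values of \<open>approves\<close> outside the voters and of \<open>cost\<close> outside
  the projects are irrelevant.
\<close>

record ('p, 'v) pb =
  projects :: "'p set"
  voters :: "'v set"
  approves :: "'v \<Rightarrow> 'p set"
  cost :: "'p \<Rightarrow> nat"
  budget :: nat
  tie_order :: "'p list"

definition pb_instance :: "('p, 'v) pb \<Rightarrow> bool" where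
  "pb_instance E \<longleftrightarrow>
     finite (projects E) \<and> finite (voters E) \<and>
     (\<forall>v\<in>voters E. approves E v \<subseteq> projects E) \<and>
     (\<forall>q\<in>projects E. 1 \<le> cost E q \<and> cost E q \<le> budget E) \<and>
     distinct (tie_order E) \<and> set (tie_order E) = projects E"

definition total_cost :: "('p, 'v) pb \<Rightarrow> 'p set \<Rightarrow> nat" where
  "total_cost E S = (\<Sum>q\<in>S. cost E q)"

type_synonym ('p, 'v) rule = "('p, 'v) pb \<Rightarrow> 'p set"

definition pb_rule :: "('p, 'v) rule \<Rightarrow> bool" where
  "pb_rule f \<longleftrightarrow>
     (\<forall>E. pb_instance E \<longrightarrow> f E \<subseteq> projects E \<and> total_cost E (f E) \<le> budget E)"

definition delete_projects :: "'p set \<Rightarrow> ('p, 'v) pb \<Rightarrow> ('p, 'v) pb" where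
  "delete_projects D E = E\<lparr>
     projects := projects E - D,
     approves := (\<lambda>v. approves E v - D),
     tie_order := filter (\<lambda>q. q \<notin> D) (tie_order E)\<rparr>"

definition same_cost :: "('p, 'v) pb \<Rightarrow> bool" where
  "same_cost E \<longleftrightarrow> (\<forall>q\<in>projects E. \<forall>q'\<in>projects E. cost E q = cost E q')"


section \<open>GreedyAV\<close>

definition score_AV :: "('p, 'v) pb \<Rightarrow> 'p \<Rightarrow> nat" where
  "score_AV E q = card {v \<in> voters E. q \<in> approves E v}"

text \<open>The function \<^const>\<open>sort_key\<close> is stable, so equal scores keep the tie-breaking order.\<close>

definition greedy_order :: "('p, 'v) pb \<Rightarrow> 'p list" where
  "greedy_order E = sort_key (\<lambda>q. - int (score_AV E q)) (tie_order E)"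

definition greedy_step :: "('p, 'v) pb \<Rightarrow> 'p \<Rightarrow> 'p set \<Rightarrow> 'p set" where
  "greedy_step E q W = (if total_cost E W + cost E q \<le> budget E then insert q W else W)"

definition greedyAV :: "('p, 'v) rule" where
  "greedyAV E = fold (greedy_step E) (greedy_order E) {}"

lemma pb_rule_greedyAV: "pb_rule greedyAV"
proof -
  have "fold (greedy_step E) qs W \<subseteq> W \<union> set qs \<and>
      total_cost E (fold (greedy_step E) qs W) \<le> budget E"
    if "finite W" "total_cost E W \<le> budget E" for E :: "('p, 'v) pb" and qs W
    using that
  proof (induction qs arbitrary: W)
    case Nil
    then show ?case by simp
  next
    case (Cons q qs)
    have "finite (greedy_step E q W)" "greedy_step E q W \<subseteq> insert q W"
      using Cons.prems by (auto simp: greedy_step_def)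
    moreover have "total_cost E (greedy_step E q W) \<le> budget E"
      using Cons.prems by (cases "q \<in> W") (auto simp: greedy_step_def total_cost_def insert_absorb)
    ultimately show ?case
      using Cons.IH[of "greedy_step E q W"] by auto
  qed
  from this[of "{}"] show ?thesis
    by (fastforce simp: pb_rule_def greedyAV_def greedy_order_def pb_instance_def total_cost_def)
qed


section \<open>Weighted control by deleting projects\<close>

record ('p, 'v) control =
  election :: "('p, 'v) pb"
  weight :: "'p \<Rightarrow> nat"
  limit :: nat
  target :: 'p

definition CC_instances :: "('p, 'v) rule \<Rightarrow> ('p, 'v) control set" where
  "CC_instances f = {I. pb_instance (election I) \<and> target I \<in> projects (election I) \<and>
     target I \<notin> f (election I)}"

definition CC_yes :: "('p, 'v) rule \<Rightarrow> ('p, 'v) control \<Rightarrow> bool" where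
  "CC_yes f I \<longleftrightarrow> (\<exists>D. D \<subseteq> projects (election I) - {target I} \<and>
     (\<Sum>q\<in>D. weight I q) \<le> limit I \<and> target I \<in> f (delete_projects D (election I)))"

definition DC_instances :: "('p, 'v) rule \<Rightarrow> ('p, 'v) control set" where
  "DC_instances f = {I. pb_instance (election I) \<and> target I \<in> projects (election I) \<and>
     target I \<in> f (election I)}"

definition DC_yes :: "('p, 'v) rule \<Rightarrow> ('p, 'v) control \<Rightarrow> bool" where
  "DC_yes f I \<longleftrightarrow> (\<exists>D. D \<subseteq> projects (election I) - {target I} \<and>
     (\<Sum>q\<in>D. weight I q) \<le> limit I \<and> target I \<notin> f (delete_projects D (election I)))"

definition same_cost_instances :: "('p, 'v) control set" where
  "same_cost_instances = {I. same_cost (election I)}"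


section \<open>Polynomial time\<close>

text \<open>
  The machine model is the random access machine of Cook and Reckhow under the logarithmic cost
  criterion, with structured control flow instead of jumps. A program uses the finitely many
  registers it mentions and an unbounded, indirectly addressed memory; all of them hold natural
  numbers. The only arithmetic operations are addition and truncated subtraction, and every
  operation is charged the lengths of all numbers and addresses it handles, so that this model and
  the Turing machine simulate each other with polynomial overhead.
\<close>

text \<open>Number of binary digits (none for 0), plus one for a delimiter.\<close>

definition nat_len :: "nat \<Rightarrow> nat" where
  "nat_len n = floorlog 2 n + 1"

definition input_len :: "nat list \<Rightarrow> nat" where
  "input_len xs = sum_list (map nat_len xs)"

record ram_state =
  reg :: "nat \<Rightarrow> nat"
  mem :: "nat \<Rightarrow> nat"

datatype instr =
    SetC nat nat        \<comment> \<open>\<open>r\<^sub>i := c\<close>\<close>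
  | Add nat nat nat     \<comment> \<open>\<open>r\<^sub>i := r\<^sub>j + r\<^sub>k\<close>\<close>
  | Sub nat nat nat     \<comment> \<open>\<open>r\<^sub>i := r\<^sub>j - r\<^sub>k\<close>\<close>
  | Load nat nat        \<comment> \<open>\<open>r\<^sub>i := mem (r\<^sub>j)\<close>\<close>
  | Store nat nat       \<comment> \<open>\<open>mem (r\<^sub>i) := r\<^sub>j\<close>\<close>

fun instr_effect :: "instr \<Rightarrow> ram_state \<Rightarrow> ram_state" where
  "instr_effect (SetC i c) s = s\<lparr>reg := (reg s)(i := c)\<rparr>"
| "instr_effect (Add i j k) s = s\<lparr>reg := (reg s)(i := reg s j + reg s k)\<rparr>"
| "instr_effect (Sub i j k) s = s\<lparr>reg := (reg s)(i := reg s j - reg s k)\<rparr>"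
| "instr_effect (Load i j) s = s\<lparr>reg := (reg s)(i := mem s (reg s j))\<rparr>"
| "instr_effect (Store i j) s = s\<lparr>mem := (mem s)(reg s i := reg s j)\<rparr>"

fun instr_cost :: "instr \<Rightarrow> ram_state \<Rightarrow> nat" where
  "instr_cost (SetC i c) s = nat_len c"
| "instr_cost (Add i j k) s = nat_len (reg s j) + nat_len (reg s k)"
| "instr_cost (Sub i j k) s = nat_len (reg s j) + nat_len (reg s k)"
| "instr_cost (Load i j) s = nat_len (reg s j) + nat_len (mem s (reg s j))"
| "instr_cost (Store i j) s = nat_len (reg s i) + nat_len (reg s j)"

datatype program =
    Instr instr
  | Seq program program
  | IfNZ nat program program
  | WhileNZ nat program

text \<open>\<open>exec c s t s'\<close>: started in \<open>s\<close>, the program \<open>c\<close> halts in \<open>s'\<close> at total cost \<open>t\<close>.\<close>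

inductive exec :: "program \<Rightarrow> ram_state \<Rightarrow> nat \<Rightarrow> ram_state \<Rightarrow> bool" where
  exec_Instr: "exec (Instr a) s (instr_cost a s) (instr_effect a s)"
| exec_Seq: "exec c1 s t1 s' \<Longrightarrow> exec c2 s' t2 s'' \<Longrightarrow> exec (Seq c1 c2) s (t1 + t2) s''"
| exec_IfTrue: "reg s i \<noteq> 0 \<Longrightarrow> exec c1 s t s' \<Longrightarrow>
    exec (IfNZ i c1 c2) s (nat_len (reg s i) + t) s'"
| exec_IfFalse: "reg s i = 0 \<Longrightarrow> exec c2 s t s' \<Longrightarrow>
    exec (IfNZ i c1 c2) s (nat_len (reg s i) + t) s'"
| exec_WhileFalse: "reg s i = 0 \<Longrightarrow> exec (WhileNZ i c) s (nat_len (reg s i)) s"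
| exec_WhileTrue: "reg s i \<noteq> 0 \<Longrightarrow> exec c s t1 s' \<Longrightarrow> exec (WhileNZ i c) s' t2 s'' \<Longrightarrow>
    exec (WhileNZ i c) s (nat_len (reg s i) + t1 + t2) s''"

lemma exec_deterministic:
  "exec c s t s' \<Longrightarrow> exec c s u s'' \<Longrightarrow> u = t \<and> s'' = s'"
proof (induction arbitrary: u s'' rule: exec.induct)
  case (exec_Instr a s)
  then show ?case by (auto elim: exec.cases)
next
  case (exec_Seq c1 s t1 s' c2 t2 s2)
  from exec_Seq.prems show ?case by cases (use exec_Seq.IH in blast)
next
  case (exec_IfTrue s i c1 t s' c2)
  from exec_IfTrue.prems show ?case by cases (use exec_IfTrue in blast)+
next
  case (exec_IfFalse s i c2 t s' c1)
  from exec_IfFalse.prems show ?case by cases (use exec_IfFalse in blast)+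
next
  case (exec_WhileFalse s i c)
  from exec_WhileFalse.prems show ?case by cases (use exec_WhileFalse in auto)
next
  case (exec_WhileTrue s i c t1 s' t2 s2)
  from exec_WhileTrue.prems show ?case by cases (use exec_WhileTrue in blast)+
qed

definition init_state :: "nat list \<Rightarrow> ram_state" where
  "init_state xs = \<lparr>
     reg = (\<lambda>i. if i = 0 then length xs else 0),
     mem = (\<lambda>i. if i < length xs then xs ! i else 0)\<rparr>"

definition accepting :: "ram_state \<Rightarrow> bool" where
  "accepting s \<longleftrightarrow> reg s 0 \<noteq> 0"

text \<open>
  A decision problem is given by its set of instances, the encoding of instances as lists of
  natural numbers, and the property of being a yes-instance.
\<close>

definition poly_time_solvable :: "('i \<Rightarrow> nat list) \<Rightarrow> 'i set \<Rightarrow> ('i \<Rightarrow> bool) \<Rightarrow> bool" where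
  "poly_time_solvable enc Inst Yes \<longleftrightarrow>
     (\<exists>c (b :: nat poly). \<forall>I\<in>Inst. \<exists>t s.
        exec c (init_state (enc I)) t s \<and>
        t \<le> poly b (input_len (enc I)) \<and>
        (accepting s \<longleftrightarrow> Yes I))"

text \<open>
  Projects and voters are named by natural numbers. The projects are listed in the tie-breaking
  order; for each voter the approval set is given by its characteristic bit vector in that order.
\<close>

definition encode :: "(nat, nat) control \<Rightarrow> nat list" where
  "encode I = (let E = election I; qs = tie_order E; vs = sorted_list_of_set (voters E) in
     [length qs, length vs, budget E, limit I, target I]
     @ concat (map (\<lambda>q. [q, cost E q, weight I q]) qs)
     @ concat (map (\<lambda>v. v # map (\<lambda>q. of_bool (q \<in> approves E v)) qs) vs))"

end

theory Submission
  imports Defs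
begin

text \<open>
  If all projects cost \<open>c\<close>, then GreedyAV funds the first \<open>budget div c\<close> projects of the greedy
  order, and deleting projects does not change the relative order of the others. Hence the target
  is funded iff fewer than \<open>budget div c\<close> surviving projects precede it. Deletions can therefore
  never hurt the target, so every instance of the destructive problem is a no-instance; in the
  constructive problem an optimal solution deletes just enough of the projects preceding the
  target, the cheapest ones first.
\<close>

section \<open>Step counting\<close>

text \<open>The number of executed steps is bounded in terms of the numbers of projects and voters
  alone, whatever the sizes of weights, costs and budget; this is why binary encoding does no harm.
  Steps are therefore counted at unit cost by \<open>run\<close>, and the passage to the logarithmic
  cost of \<open>exec\<close> is made once for all programs.

  A machine that only adds and subtracts shapes the algorithm. The quotient
  \<open>budget div c\<close> is never computed: the total cost of the target and its predecessors
  is compared with the budget, and every deletion subtracts \<open>c\<close> from it. No list is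
  sorted either: predecessors are recognised by comparison with the target alone, and the cheapest
  candidate is found by a fresh maximum search in each round.\<close>

inductive run :: "program \<Rightarrow> ram_state \<Rightarrow> nat \<Rightarrow> ram_state \<Rightarrow> bool" where
  run_Instr: "run (Instr a) s 1 (instr_effect a s)"
| run_Seq: "run c1 s k1 s' \<Longrightarrow> run c2 s' k2 s'' \<Longrightarrow> run (Seq c1 c2) s (k1 + k2) s''"
| run_IfTrue: "reg s i \<noteq> 0 \<Longrightarrow> run c1 s k s' \<Longrightarrow> run (IfNZ i c1 c2) s (Suc k) s'"
| run_IfFalse: "reg s i = 0 \<Longrightarrow> run c2 s k s' \<Longrightarrow> run (IfNZ i c1 c2) s (Suc k) s'"
| run_WhileFalse: "reg s i = 0 \<Longrightarrow> run (WhileNZ i c) s 1 s"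
| run_WhileTrue: "reg s i \<noteq> 0 \<Longrightarrow> run c s k1 s' \<Longrightarrow> run (WhileNZ i c) s' k2 s'' \<Longrightarrow>
    run (WhileNZ i c) s (Suc (k1 + k2)) s''"

inductive_cases run_InstrE: "run (Instr a) s k s'"
inductive_cases run_SeqE: "run (Seq c1 c2) s k s'"
inductive_cases run_IfE: "run (IfNZ i c1 c2) s k s'"

definition bits_bounded :: "nat \<Rightarrow> ram_state \<Rightarrow> bool" where
  "bits_bounded b s \<longleftrightarrow> (\<forall>i. reg s i < 2 ^ b) \<and> (\<forall>i. mem s i < 2 ^ b)"

fun instr_consts :: "instr \<Rightarrow> nat set" where
  "instr_consts (SetC i c) = {c}"
| "instr_consts _ = {}"

fun consts_of :: "program \<Rightarrow> nat set" where
  "consts_of (Instr a) = instr_consts a"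
| "consts_of (Seq c1 c2) = consts_of c1 \<union> consts_of c2"
| "consts_of (IfNZ i c1 c2) = consts_of c1 \<union> consts_of c2"
| "consts_of (WhileNZ i c) = consts_of c"

lemma nat_len_le_iff: "nat_len x \<le> Suc b \<longleftrightarrow> x < 2 ^ b"
  by (cases "x = 0") (auto simp: nat_len_def floorlog_le_iff)

lemma length_le_input_len: "length xs \<le> input_len xs"
  by (induction xs) (auto simp: input_len_def nat_len_def)

lemma bits_bounded_mono: "bits_bounded b s \<Longrightarrow> b \<le> b' \<Longrightarrow> bits_bounded b' s"
  unfolding bits_bounded_def by (meson less_le_trans one_le_numeral power_increasing)

text \<open>An instruction is charged for at most two numbers, each of at most \<open>b\<close>
  digits plus a delimiter; only \<open>Add\<close> can leave the old bound, and it at most doubles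
  it.\<close>

lemma bits_bounded_instr:
  assumes "bits_bounded b s" "\<forall>x\<in>instr_consts a. x < 2 ^ b"
  shows "bits_bounded (Suc b) (instr_effect a s)" "instr_cost a s \<le> 2 * Suc b"
proof -
  have s: "reg s i < 2 ^ b" "mem s i < 2 ^ b" for i
    using assms by (auto simp: bits_bounded_def)
  have s': "reg s i < 2 * 2 ^ b" "mem s i < 2 * 2 ^ b" for i
    using s[of i] by linarith+
  have d: "reg s i + reg s j < 2 * 2 ^ b" for i j
    using s(1)[of i] s(1)[of j] by linarith
  have m: "reg s i - reg s j < 2 * 2 ^ b" for i j
    using s(1)[of i] by linarith
  show "bits_bounded (Suc b) (instr_effect a s)"
    using assms(2) by (cases a) (auto simp: bits_bounded_def s' d m)
  have l: "nat_len (reg s i) \<le> Suc b" "nat_len (mem s i) \<le> Suc b" for i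
    using s by (auto simp: nat_len_le_iff)
  show "instr_cost a s \<le> 2 * Suc b"
  proof (cases a)
    case (SetC i c)
    then have "nat_len c \<le> Suc b" using assms(2) by (auto simp: nat_len_le_iff)
    then show ?thesis using SetC by simp
  next
    case (Add i j k)
    then show ?thesis using l(1)[of j] l(1)[of k] by simp
  next
    case (Sub i j k)
    then show ?thesis using l(1)[of j] l(1)[of k] by simp
  next
    case (Load i j)
    then show ?thesis using l(1)[of j] l(2)[of "reg s j"] by simp
  next
    case (Store i j)
    then show ?thesis using l(1)[of i] l(1)[of j] by simp
  qed
qed

lemma bits_bounded_init: "bits_bounded (input_len xs) (init_state xs)"
proof -
  have "length xs < 2 ^ input_len xs"
    using length_le_input_len[of xs] less_exp[of "input_len xs"] by linarith
  moreover have "xs ! i < 2 ^ input_len xs" if "i < length xs" for i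
  proof -
    have "nat_len (xs ! i) \<le> input_len xs"
      unfolding input_len_def using that by (intro member_le_sum_list) auto
    then show ?thesis using nat_len_le_iff[of "xs ! i" "input_len xs"] by simp
  qed
  ultimately show ?thesis by (auto simp: bits_bounded_def init_state_def)
qed

text \<open>
  An instruction lengthens the longest number by at most one bit, so the logarithmic cost is
  polynomial in the number of steps.
\<close>

lemma run_imp_exec:
  assumes "run c s k s'" "bits_bounded b s" "\<forall>x\<in>consts_of c. x < 2 ^ b" "b + k \<le> u"
  shows "\<exists>t. exec c s t s' \<and> t \<le> k * (2 * Suc u) \<and> bits_bounded (b + k) s'"
  using assms
\<comment> \<open>The bound \<open>b\<close> grows along the run and is generalised;
  \<open>u\<close> dominates all its intermediate values and stays fixed, which makes the cost bound
  additive in the steps.\<close>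
proof (induction arbitrary: b rule: run.induct)
  case (run_Instr a s)
  then show ?case using bits_bounded_instr[of b s a]
    by (intro exI[of _ "instr_cost a s"]) (auto intro: exec_Instr)
next
  case (run_Seq c1 s k1 s' c2 k2 s'')
  obtain t1 where t1: "exec c1 s t1 s'" "t1 \<le> k1 * (2 * Suc u)" "bits_bounded (b + k1) s'"
    using run_Seq.IH(1)[of b] run_Seq.prems by auto
  have "\<forall>x\<in>consts_of c2. x < 2 ^ (b + k1)"
    using run_Seq.prems by (auto simp: power_add intro: less_le_trans)
  then obtain t2 where "exec c2 s' t2 s''" "t2 \<le> k2 * (2 * Suc u)" "bits_bounded (b + k1 + k2) s''"
    using run_Seq.IH(2)[of "b + k1"] run_Seq.prems t1 by auto
  with t1 show ?case
    by (intro exI[of _ "t1 + t2"]) (auto intro: exec.exec_Seq simp: algebra_simps)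
next
  case (run_IfTrue s i c1 k s' c2)
  obtain t where t: "exec c1 s t s'" "t \<le> k * (2 * Suc u)" "bits_bounded (b + k) s'"
    using run_IfTrue.IH[of b] run_IfTrue.prems by auto
  have "nat_len (reg s i) \<le> Suc b"
    using run_IfTrue.prems by (auto simp: nat_len_le_iff bits_bounded_def)
  with t run_IfTrue show ?case
    by (intro exI[of _ "nat_len (reg s i) + t"])
      (auto intro: exec.exec_IfTrue bits_bounded_mono)
next
  case (run_IfFalse s i c2 k s' c1)
  obtain t where t: "exec c2 s t s'" "t \<le> k * (2 * Suc u)" "bits_bounded (b + k) s'"
    using run_IfFalse.IH[of b] run_IfFalse.prems by auto
  have "nat_len (reg s i) \<le> Suc b"
    using run_IfFalse.prems by (auto simp: nat_len_le_iff bits_bounded_def)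
  with t run_IfFalse show ?case
    using exec.exec_IfFalse[of s i c2 t s' c1]
    by (intro exI[of _ "nat_len (reg s i) + t"]) (auto intro: bits_bounded_mono)
next
  case (run_WhileFalse s i c)
  have "nat_len (reg s i) \<le> Suc b"
    using run_WhileFalse.prems by (auto simp: nat_len_le_iff bits_bounded_def)
  with run_WhileFalse show ?case
    using exec.exec_WhileFalse[of s i c]
    by (intro exI[of _ "nat_len (reg s i)"]) (auto intro: bits_bounded_mono)
next
  case (run_WhileTrue s i c k1 s' k2 s'')
  obtain t1 where t1: "exec c s t1 s'" "t1 \<le> k1 * (2 * Suc u)" "bits_bounded (b + k1) s'"
    using run_WhileTrue.IH(1)[of b] run_WhileTrue.prems by auto
  have "\<forall>x\<in>consts_of (WhileNZ i c). x < 2 ^ (b + k1)"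
    using run_WhileTrue.prems by (auto simp: power_add intro: less_le_trans)
  then obtain t2 where "exec (WhileNZ i c) s' t2 s''" "t2 \<le> k2 * (2 * Suc u)"
      "bits_bounded (b + k1 + k2) s''"
    using run_WhileTrue.IH(2)[of "b + k1"] run_WhileTrue.prems t1 by auto
  moreover have "nat_len (reg s i) \<le> Suc b"
    using run_WhileTrue.prems by (auto simp: nat_len_le_iff bits_bounded_def)
  moreover from calculation have "exec (WhileNZ i c) s (nat_len (reg s i) + t1 + t2) s''"
    using t1 run_WhileTrue by (blast intro: exec.exec_WhileTrue)
  ultimately show ?case using t1 run_WhileTrue.prems(3)
    by (intro exI[of _ "nat_len (reg s i) + t1 + t2"])
      (auto intro: bits_bounded_mono simp: algebra_simps)
qed

text \<open>Total correctness: a terminating run must exist. The postcondition also receives the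
  step counter, so invariants carry time bounds together with the state, and the equations below
  execute straight-line code symbolically.\<close>

definition wp :: "program \<Rightarrow> (nat \<Rightarrow> ram_state \<Rightarrow> bool) \<Rightarrow> nat \<Rightarrow> ram_state \<Rightarrow> bool" where
  "wp c Q k s \<longleftrightarrow> (\<exists>j s'. run c s j s' \<and> Q (k + j) s')"

lemma wp_Instr [simp]: "wp (Instr a) Q k s \<longleftrightarrow> Q (Suc k) (instr_effect a s)"
proof
  assume "Q (Suc k) (instr_effect a s)"
  then show "wp (Instr a) Q k s"
    using run_Instr[of a s] unfolding wp_def by (intro exI[of _ 1]) auto
qed (auto simp: wp_def elim!: run_InstrE)

lemma wp_Seq [simp]: "wp (Seq c1 c2) Q k s \<longleftrightarrow> wp c1 (wp c2 Q) k s"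
  by (fastforce simp: wp_def add.assoc elim!: run_SeqE intro: run_Seq)

lemma wp_If [simp]:
  "wp (IfNZ i c1 c2) Q k s \<longleftrightarrow>
     (if reg s i \<noteq> 0 then wp c1 Q (Suc k) s else wp c2 Q (Suc k) s)"
proof -
  have "run (IfNZ i c1 c2) s j s' \<longleftrightarrow>
      (\<exists>j'. j = Suc j' \<and> run (if reg s i \<noteq> 0 then c1 else c2) s j' s')" for j s'
    by (auto elim!: run_IfE intro: run_IfTrue run_IfFalse)
  then show ?thesis by (simp add: wp_def) (metis add_Suc_right)
qed

text \<open>Each loop considered here has an iteration count known on entry. Indexing the invariant
  by the finished rounds replaces a termination measure and lets the invariant state a step bound
  for each round.\<close>

lemma wp_While:
  assumes init: "I 0 k s"
    and step: "\<And>j k s. j < N \<Longrightarrow> I j k s \<Longrightarrow> reg s i \<noteq> 0 \<and> wp c (I (Suc j)) (Suc k) s"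
    and exit: "\<And>k s. I N k s \<Longrightarrow> reg s i = 0 \<and> Q (Suc k) s"
  shows "wp (WhileNZ i c) Q k s"
proof -
  have "wp (WhileNZ i c) Q k s" if "I j k s" "j \<le> N" for j k s
    using that(2,1)
  \<comment> \<open>Downward from the last round, because the run of a loop is built from its
    end.\<close>
  proof (induction j arbitrary: k s rule: inc_induct)
    case base
    then show ?case
      using exit[of k s] run_WhileFalse[of s i c] unfolding wp_def by (intro exI[of _ 1]) auto
  next
    case (step j)
    from assms(2)[OF step.hyps(2) step.prems] obtain k1 s'
      where *: "reg s i \<noteq> 0" "run c s k1 s'" "I (Suc j) (Suc k + k1) s'"
      by (auto simp: wp_def)
    from step.IH[OF *(3)] show ?case
      using run_WhileTrue[OF *(1,2)] by (fastforce simp: wp_def add.assoc)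
  qed
  from this[OF init] show ?thesis by simp
qed

section \<open>The program for constructive control\<close>

text \<open>
  Registers: 0 length \<open>L\<close> of the input and address of a free array of size \<open>n\<close>, 1 number \<open>n\<close> of
  projects, 2 number of voters, 3 budget, 4 limit plus one, 5 target, 6 common cost, 8 length
  \<open>n + 1\<close> of a ballot, and the constants 1, 0 and 3 in 7, 20 and 21.
\<close>

abbreviation seq_prog (infixr ";;" 60) where "c1 ;; c2 \<equiv> Seq c1 c2"

text \<open>Register 13 walks down one column of the approval matrix in steps of the ballot length,
  14 counts the remaining voters and 15 collects the approvals.\<close>

definition score_loop :: program where
  "score_loop = WhileNZ 14
     (Instr (Load 18 13) ;; Instr (Add 15 15 18) ;; Instr (Add 13 13 8) ;; Instr (Sub 14 14 7))"

text \<open>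
  Register 16 is 1 until the target has been met. Adding it to the score of a project breaks ties:
  a project precedes the target iff the resulting number exceeds the target's score, which is kept
  in register 17.
\<close>

definition rank_body :: program where
  "rank_body =
     Instr (Add 13 9 20) ;; Instr (Add 14 2 20) ;; Instr (Add 15 20 20) ;;
     score_loop ;;
     Instr (Load 18 10) ;; Instr (Sub 19 18 5) ;; Instr (Sub 18 5 18) ;; Instr (Add 18 18 19) ;;
     IfNZ 18 (Instr (Add 15 15 16)) (Instr (Add 17 15 20) ;; Instr (SetC 16 0)) ;;
     Instr (Store 11 15) ;;
     Instr (Add 9 9 7) ;; Instr (Add 10 10 21) ;; Instr (Add 11 11 7) ;; Instr (Sub 12 12 7)"

text \<open>
  Register 15 becomes the total cost of the target and the projects preceding it. A project
  preceding the target gets the key \<open>limit + 1 - weight\<close>, every other project the key 0, so that the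
  cheapest deletable project is the one of largest key. Projects too heavy to be deleted also get 0.
\<close>

definition key_body :: program where
  "key_body =
     Instr (Load 18 11) ;; Instr (Sub 18 18 17) ;;
     IfNZ 18 (Instr (Load 18 10) ;; Instr (Sub 18 4 18) ;; Instr (Add 15 15 6)) (Instr (SetC 18 0)) ;;
     Instr (Store 11 18) ;;
     Instr (Add 10 10 21) ;; Instr (Add 11 11 7) ;; Instr (Sub 12 12 7)"

text \<open>The truncated difference is nonzero exactly for an entry above the running maximum. In
  the other branch register 19 is already 0, so \<open>SetC 19 0\<close> serves as an empty
  program.\<close>

definition max_loop :: program where
  "max_loop = WhileNZ 12
     (Instr (Load 17 11) ;; Instr (Sub 19 17 13) ;;
      IfNZ 19 (Instr (Add 13 17 20) ;; Instr (Add 14 11 20)) (Instr (SetC 19 0)) ;;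
      Instr (Add 11 11 7) ;; Instr (Sub 12 12 7))"

text \<open>
  If the largest key is 0, the accumulated weight in register 16 grows by \<open>limit + 1\<close>; this rejects
  without a separate test that no candidate for deletion is left.
\<close>

definition delete_body :: program where
  "delete_body =
     Instr (Add 11 0 20) ;; Instr (Add 12 1 20) ;; Instr (SetC 13 0) ;; Instr (Add 14 0 20) ;;
     max_loop ;;
     Instr (Sub 19 4 13) ;; Instr (Add 16 16 19) ;; Instr (Store 14 20) ;;
     Instr (Sub 15 15 6) ;; Instr (Sub 18 15 3)"

text \<open>Register 6 first holds the address 6. It doubles as the offset that makes register 9
  equal to \<open>3 * n + 6\<close>, the address of the first approval bit, and is then replaced by
  the cost of the first listed project, which is stored there.\<close>

definition setup_prog :: program where
  "setup_prog =
     Instr (SetC 7 1) ;; Instr (SetC 20 0) ;; Instr (SetC 21 3) ;;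
     Instr (Load 1 20) ;; Instr (Load 2 7) ;;
     Instr (SetC 3 2) ;; Instr (Load 3 3) ;;
     Instr (Load 4 21) ;; Instr (Add 4 4 7) ;;
     Instr (SetC 5 4) ;; Instr (Load 5 5) ;;
     Instr (SetC 6 6) ;; Instr (Add 9 1 1) ;; Instr (Add 9 9 1) ;; Instr (Add 9 9 6) ;;
     Instr (Load 6 6) ;; Instr (Add 8 1 7) ;;
     Instr (SetC 10 5) ;; Instr (Add 11 0 20) ;; Instr (Add 12 1 20) ;;
     Instr (SetC 16 1) ;; Instr (SetC 17 0)"

definition cc_prog :: program where
  "cc_prog =
     setup_prog ;;
     WhileNZ 12 rank_body ;;
     Instr (SetC 10 7) ;; Instr (Add 11 0 20) ;; Instr (Add 12 1 20) ;; Instr (Add 15 6 20) ;;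
     WhileNZ 12 key_body ;;
     Instr (SetC 16 0) ;; Instr (Sub 18 15 3) ;;
     WhileNZ 18 delete_body ;;
     Instr (Sub 0 4 16)"

section \<open>Invariants of the inner loops\<close>

lemma wp_score_loop:
  assumes "reg s 7 = 1"
    and "\<And>k' s'. k' \<le> k + 5 * reg s 14 + 1 \<Longrightarrow> mem s' = mem s \<Longrightarrow>
      \<forall>r. r \<notin> {13, 14, 15, 18} \<longrightarrow> reg s' r = reg s r \<Longrightarrow>
      reg s' 15 = reg s 15 + (\<Sum>v<reg s 14. mem s (reg s 13 + v * reg s 8)) \<Longrightarrow> Q k' s'"
  shows "wp score_loop Q k s"
  unfolding score_loop_def
\<comment> \<open>Five steps per voter: the test and the four instructions of the body.\<close>
proof (rule wp_While[where N = "reg s 14" and I = "\<lambda>j k' s'. k' \<le> k + 5 * j \<and> mem s' = mem s \<and>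
      (\<forall>r. r \<notin> {13, 14, 15, 18} \<longrightarrow> reg s' r = reg s r) \<and>
      reg s' 13 = reg s 13 + j * reg s 8 \<and> reg s' 14 = reg s 14 - j \<and>
      reg s' 15 = reg s 15 + (\<Sum>v<j. mem s (reg s 13 + v * reg s 8))"], goal_cases)
  case (2 j k s)
  then show ?case using assms(1) by (auto simp: algebra_simps)
next
  case (3 k s)
  then show ?case using assms(2) by auto
qed auto

lemma wp_max_loop:
  assumes "reg s0 7 = 1" "reg s0 20 = 0" "reg s0 13 = 0" "reg s0 11 = a" "reg s0 14 = a"
    and "reg s0 12 = n" "0 < n"
    and "\<And>k' s' i. k' \<le> k0 + 8 * n + 1 \<Longrightarrow> mem s' = mem s0 \<Longrightarrow>
      \<forall>r. r \<notin> {11, 12, 13, 14, 17, 19} \<longrightarrow> reg s' r = reg s0 r \<Longrightarrow>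
      i < n \<Longrightarrow> reg s' 14 = a + i \<Longrightarrow> reg s' 13 = mem s0 (a + i) \<Longrightarrow>
      \<forall>j<n. mem s0 (a + j) \<le> mem s0 (a + i) \<Longrightarrow> Q k' s'"
  shows "wp max_loop Q k0 s0"
  unfolding max_loop_def
proof (rule wp_While[where N = n and I = "\<lambda>j k' s'. k' \<le> k0 + 8 * j \<and> mem s' = mem s0 \<and>
      (\<forall>r. r \<notin> {11, 12, 13, 14, 17, 19} \<longrightarrow> reg s' r = reg s0 r) \<and>
      reg s' 11 = a + j \<and> reg s' 12 = n - j \<and>
      (\<exists>i<n. reg s' 14 = a + i \<and> (reg s' 13 = 0 \<or> reg s' 13 = mem s0 (a + i))) \<and>
      (\<forall>i<j. mem s0 (a + i) \<le> reg s' 13)"], goal_cases)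
  case 1
  then show ?case using assms(1-7) by auto
next
  case (2 j k s)
  then have inv: "k \<le> k0 + 8 * j" "mem s = mem s0"
    "\<And>r. r \<notin> {11, 12, 13, 14, 17, 19} \<Longrightarrow> reg s r = reg s0 r"
    "reg s 11 = a + j" "reg s 12 = n - j" "\<forall>i<j. mem s0 (a + i) \<le> reg s 13" "j < n"
    by auto
  from 2 obtain i where i: "i < n" "reg s 14 = a + i" "reg s 13 = 0 \<or> reg s 13 = mem s0 (a + i)"
    by blast
  have regs: "reg s 7 = 1" "reg s 20 = 0" using inv(3) assms(1,2) by simp_all
  show ?case
  proof (cases "mem s0 (a + j) \<le> reg s 13")
    case True
    then have "\<forall>i<Suc j. mem s0 (a + i) \<le> reg s 13" using inv(6) by (simp add: less_Suc_eq)
    then show ?thesis using True inv regs i by auto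
  next
    case False
    then have "\<forall>i<Suc j. mem s0 (a + i) \<le> mem s0 (a + j)"
      using inv(6) by (metis less_Suc_eq nat_le_linear order.trans)
    then show ?thesis using False inv regs by auto
  qed
next
  case (3 k s)
  then have inv: "k \<le> k0 + 8 * n" "mem s = mem s0"
    "\<forall>r. r \<notin> {11, 12, 13, 14, 17, 19} \<longrightarrow> reg s r = reg s0 r"
    "reg s 12 = 0" "\<forall>i<n. mem s0 (a + i) \<le> reg s 13"
    by auto
  from 3 obtain i where i: "i < n" "reg s 14 = a + i" "reg s 13 = 0 \<or> reg s 13 = mem s0 (a + i)"
    by blast
  \<comment> \<open>The running maximum starts at the default 0, not at an entry. If it is still 0
    at the end, all entries vanish and entry \<open>i\<close> agrees with it as well.\<close>
  then have max: "reg s 13 = mem s0 (a + i)" using inv(5) by fastforce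
  have "Q (Suc k) s"
    using assms(8)[OF _ inv(2,3) i(1,2) max] inv(1,5) max by simp
  with inv(4) show ?case by simp
qed

text \<open>Here \<open>d\<close> counts the deletions still to be made and \<open>acc\<close> is
  the weight already spent, so that a round of the deletion loop can preserve the truth
  value.\<close>

definition selectable :: "('a \<Rightarrow> nat) \<Rightarrow> nat \<Rightarrow> 'a set \<Rightarrow> nat \<Rightarrow> nat \<Rightarrow> bool" where
  "selectable w r S d acc \<longleftrightarrow> (\<exists>D\<subseteq>S. card D = d \<and> acc + sum w D \<le> r)"

text \<open>An exchange argument: some optimal selection contains the cheapest element.\<close>

lemma selectable_greedy:
  assumes S: "finite S" "q \<in> S" "\<forall>x\<in>S. w q \<le> w x"
  shows "selectable w r S (Suc d) acc \<longleftrightarrow> selectable w r (S - {q}) d (acc + w q)"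
  unfolding selectable_def
proof
  assume "\<exists>D\<subseteq>S. card D = Suc d \<and> acc + sum w D \<le> r"
  then obtain D where D: "D \<subseteq> S" "card D = Suc d" "acc + sum w D \<le> r" by blast
  have fin: "finite D" using D S finite_subset by blast
  \<comment> \<open>The element to be exchanged for \<open>q\<close>; it is \<open>q\<close> itself
    if \<open>q\<close> was selected anyway.\<close>
  obtain x where x: "x \<in> D" "q \<in> D \<longrightarrow> x = q"
    using D(2) by (cases "q \<in> D") (auto simp: card_Suc_eq)
  have "w q \<le> w x" using x D S by blast
  moreover have "sum w D = w x + sum w (D - {x})" using fin x by (simp add: sum.remove)
  ultimately have "acc + w q + sum w (D - {x}) \<le> r" using D(3) by linarith
  then show "\<exists>D\<subseteq>S - {q}. card D = d \<and> acc + w q + sum w D \<le> r"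
    using D x fin by (intro exI[of _ "D - {x}"]) (auto simp: card_Diff_singleton)
next
  assume "\<exists>D\<subseteq>S - {q}. card D = d \<and> acc + w q + sum w D \<le> r"
  then obtain D where D: "D \<subseteq> S - {q}" "card D = d" "acc + w q + sum w D \<le> r" by blast
  have "finite D" using D S finite_subset by blast
  then show "\<exists>D\<subseteq>S. card D = Suc d \<and> acc + sum w D \<le> r"
    using D S by (intro exI[of _ "insert q D"]) (auto simp: card_insert_if)
qed

section \<open>Correctness of the program\<close>

text \<open>Separates the machine level from elections: only the layout of the input cells
  \<open>M\<close> is known, with \<open>ip\<close> as the position of the target. Cell 6 is the
  cost of the first listed project, standing for the common cost.\<close>

locale cc_data =
  fixes M :: "nat \<Rightarrow> nat" and n m L B lim tgt c ip :: nat
  assumes L: "L = 5 + 3 * n + m * Suc n"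
    and header: "M 0 = n" "M 1 = m" "M 2 = B" "M 3 = lim" "M 4 = tgt" "M 6 = c"
    and ip: "ip < n" "\<And>j. j < n \<Longrightarrow> M (5 + 3 * j) = tgt \<longleftrightarrow> j = ip"
    and c: "1 \<le> c"
begin

text \<open>The offset skips 5 header cells, \<open>3 * n\<close> project cells and the voter's name
  at the start of a ballot.\<close>

definition score :: "nat \<Rightarrow> nat" where
  "score j = (\<Sum>v<m. M (6 + 3 * n + j + v * Suc n))"

definition rank :: "nat \<Rightarrow> nat" where
  "rank j = score j + of_bool (j < ip)"

definition weight_at :: "nat \<Rightarrow> nat" where
  "weight_at j = M (7 + 3 * j)"

definition ahead :: "nat set" where
  "ahead = {j. j < n \<and> score ip < rank j}"

definition key :: "nat \<Rightarrow> nat" where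
  "key j = (if score ip < rank j then Suc lim - weight_at j else 0)"

text \<open>The memory after \<open>j\<close> rounds of a loop filling the array at \<open>L\<close>
  with the values of \<open>f\<close>. A store then just increments \<open>j\<close>, and the input
  below \<open>L\<close> stays readable.\<close>

definition overlay :: "(nat \<Rightarrow> nat) \<Rightarrow> nat \<Rightarrow> (nat \<Rightarrow> nat) \<Rightarrow> nat \<Rightarrow> nat" where
  "overlay f j g i = (if L \<le> i \<and> i < L + j then f (i - L) else g i)"

definition fixed_regs :: "ram_state \<Rightarrow> bool" where
  "fixed_regs s \<longleftrightarrow> reg s 0 = L \<and> reg s (Suc 0) = n \<and> reg s 2 = m \<and> reg s 3 = B \<and>
     reg s 4 = Suc lim \<and> reg s 5 = tgt \<and> reg s 6 = c \<and> reg s 7 = 1 \<and> reg s 8 = Suc n \<and>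
     reg s 20 = 0 \<and> reg s 21 = 3"

lemma overlay_0 [simp]: "overlay f 0 g = g"
  by (auto simp: overlay_def)

lemma overlay_below [simp]: "i < L \<Longrightarrow> overlay f j g i = g i"
  by (auto simp: overlay_def)

lemma overlay_at [simp]: "overlay f j g (L + i) = (if i < j then f i else g (L + i))"
  by (auto simp: overlay_def)

lemma overlay_Suc [simp]: "(overlay f j g)(L + j := f j) = overlay f (Suc j) g"
  by (auto simp: overlay_def fun_eq_iff less_Suc_eq)

lemma entry_below: "j < n \<Longrightarrow> 5 + 3 * j < L" "j < n \<Longrightarrow> 7 + 3 * j < L"
  unfolding L by (auto simp: algebra_simps)

lemma vote_below:
  assumes "j < n" "v < m"
  shows "6 + 3 * n + j + v * Suc n < L"
proof -
  have "Suc v * Suc n \<le> m * Suc n" using assms by (intro mult_le_mono1) auto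
  then show ?thesis using assms unfolding L by simp
qed

lemma wp_rank_loop:
  assumes "fixed_regs s" "mem s = M" "reg s 9 = 6 + 3 * n" "reg s 10 = 5" "reg s 11 = L"
    "reg s 12 = n" "reg s 16 = 1" "reg s 17 = 0"
    and Q: "\<And>k' s'. k' \<le> k + n * (5 * m + 20) + 1 \<Longrightarrow> fixed_regs s' \<Longrightarrow>
      mem s' = overlay rank n M \<Longrightarrow> reg s' 17 = score ip \<Longrightarrow> Q k' s'"
  shows "wp (WhileNZ 12 rank_body) Q k s"
proof (rule wp_While[where N = n and I = "\<lambda>j k' s'. k' \<le> k + j * (5 * m + 20) \<and> fixed_regs s' \<and>
      mem s' = overlay rank j M \<and> reg s' 9 = 6 + 3 * n + j \<and> reg s' 10 = 5 + 3 * j \<and>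
      reg s' 11 = L + j \<and> reg s' 12 = n - j \<and> reg s' 16 = of_bool (j \<le> ip) \<and>
      reg s' 17 = (if ip < j then score ip else 0)"], goal_cases)
  case 1
  then show ?case using assms by simp
next
  case (2 j k' s')
  note less = 2(1)
  note inv = 2(2)[unfolded fixed_regs_def]
  have sum: "(\<Sum>v<m. overlay rank j M (6 + 3 * n + j + v * Suc n)) = score j"
    unfolding score_def using 2(1) vote_below by (intro sum.cong) auto
  have q: "overlay rank j M (5 + 3 * j) = M (5 + 3 * j)"
    using entry_below 2(1) by simp
  \<comment> \<open>The machine's equality test: both truncated differences vanish only for equal
    names.\<close>
  have ne: "M (5 + 3 * j) - tgt + (tgt - M (5 + 3 * j)) = 0 \<longleftrightarrow> j = ip"
    using ip(2)[OF 2(1)] by auto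
  have "wp rank_body (\<lambda>k'' s''. k'' \<le> k + Suc j * (5 * m + 20) \<and> fixed_regs s'' \<and>
      mem s'' = overlay rank (Suc j) M \<and> reg s'' 9 = 6 + 3 * n + Suc j \<and>
      reg s'' 10 = 5 + 3 * Suc j \<and>
      reg s'' 11 = L + Suc j \<and> reg s'' 12 = n - Suc j \<and> reg s'' 16 = of_bool (Suc j \<le> ip) \<and>
      reg s'' 17 = (if ip < Suc j then score ip else 0)) (Suc k') s'"
    unfolding rank_body_def wp_Seq wp_Instr
  proof (rule wp_score_loop, goal_cases)
    case 1
    then show ?case using inv by simp
  next
    case (2 k2 s2)
    have s2: "reg s2 15 = score j" "mem s2 = overlay rank j M"
      using 2(4) 2(2) inv sum by (auto simp: algebra_simps)
    have r: "rank j = (if j < ip then Suc (score j) else score j)" by (simp add: rank_def)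
    have regs: "reg s2 0 = L" "reg s2 (Suc 0) = n" "reg s2 2 = m" "reg s2 3 = B" "reg s2 4 = Suc lim"
      "reg s2 5 = tgt" "reg s2 6 = c" "reg s2 7 = 1" "reg s2 8 = Suc n" "reg s2 20 = 0"
      "reg s2 21 = 3" "reg s2 9 = 6 + 3 * n + j" "reg s2 10 = 5 + 3 * j" "reg s2 11 = L + j"
      "reg s2 12 = n - j" "reg s2 16 = of_bool (j \<le> ip)" "reg s2 17 = (if ip < j then score ip else 0)"
      using 2(3) inv by simp_all
    have time: "k2 \<le> k + j * (5 * m + 20) + 5 * m + 5" using 2(1) inv by simp
    have st: "(overlay rank j M)(L + j := rank j) = overlay rank (Suc j) M" by simp
    show ?case
    proof (cases "j = ip")
      case True
      then have "M (5 + 3 * j) = tgt" using ip(2)[OF less] by simp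
      then show ?thesis using True time st r q regs s2
        by (simp add: fixed_regs_def del: overlay_Suc)
    next
      case False
      then have neq: "M (5 + 3 * j) - tgt \<noteq> 0 \<or> tgt - M (5 + 3 * j) \<noteq> 0" using ne by simp
      from False consider "j < ip" | "ip < j" by linarith
      then show ?thesis
      proof cases
        case 1
        then show ?thesis using time st neq by (auto simp: s2 regs q fixed_regs_def r simp del: overlay_Suc)
      next
        case 2
        then show ?thesis using time st neq by (auto simp: s2 regs q fixed_regs_def r simp del: overlay_Suc)
      qed
    qed
  qed
  then show ?case using 2(1) inv by simp
next
  case (3 k' s')
  then show ?case using Q[of "Suc k'" s'] ip by simp
qed

lemma wp_key_loop:
  assumes "fixed_regs s" "mem s = overlay rank n M" "reg s 10 = 7" "reg s 11 = L"
    "reg s 12 = n" "reg s 15 = c" "reg s 17 = score ip"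
    and Q: "\<And>k' s'. k' \<le> k + n * 20 + 1 \<Longrightarrow> fixed_regs s' \<Longrightarrow>
      (\<And>j. j < n \<Longrightarrow> mem s' (L + j) = key j) \<Longrightarrow> reg s' 15 = c * Suc (card ahead) \<Longrightarrow> Q k' s'"
  shows "wp (WhileNZ 12 key_body) Q k s"
proof (rule wp_While[where N = n and I = "\<lambda>j k' s'. k' \<le> k + j * 20 \<and> fixed_regs s' \<and>
      mem s' = overlay key j (overlay rank n M) \<and> reg s' 10 = 7 + 3 * j \<and>
      reg s' 11 = L + j \<and> reg s' 12 = n - j \<and> reg s' 17 = score ip \<and>
      reg s' 15 = c * Suc (card {i. i < j \<and> score ip < rank i})"], goal_cases)
  case 1
  then show ?case using assms by simp
next
  case (2 j k' s')
  have "{i. i < Suc j \<and> score ip < rank i} =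
      (if score ip < rank j then insert j else id) {i. i < j \<and> score ip < rank i}"
    by (auto simp: less_Suc_eq)
  then have card: "card {i. i < Suc j \<and> score ip < rank i} =
      card {i. i < j \<and> score ip < rank i} + (if score ip < rank j then 1 else 0)"
    by simp
  have k: "key j = (if score ip < rank j then Suc lim - weight_at j else 0)" by (fact key_def)
  have q: "overlay key j (overlay rank n M) (7 + 3 * j) = weight_at j"
    using entry_below 2(1) by (simp add: weight_at_def)
  have st: "(overlay key j g)(L + j := key j) = overlay key (Suc j) g" for g by simp
  note inv = 2(2)[unfolded fixed_regs_def]
  have regs: "reg s' 0 = L" "reg s' (Suc 0) = n" "reg s' 2 = m" "reg s' 3 = B" "reg s' 4 = Suc lim"
    "reg s' 5 = tgt" "reg s' 6 = c" "reg s' 7 = 1" "reg s' 8 = Suc n" "reg s' 20 = 0"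
    "reg s' 21 = 3" "reg s' 10 = 7 + 3 * j" "reg s' 11 = L + j" "reg s' 12 = n - j"
    "reg s' 17 = score ip" "reg s' 15 = c * Suc (card {i. i < j \<and> score ip < rank i})"
    "mem s' = overlay key j (overlay rank n M)"
    using inv by simp_all
  have time: "k' \<le> k + j * 20" using inv by simp
  show ?case using 2(1) time st[of "overlay rank n M"] unfolding key_body_def card
    by (cases "score ip < rank j") (simp_all add: regs fixed_regs_def q k del: overlay_Suc)
next
  case (3 k' s')
  then show ?case using Q[of "Suc k'" s'] by (simp add: ahead_def)
qed

lemma wp_delete_loop:
  assumes "fixed_regs s" "\<And>j. j < n \<Longrightarrow> mem s (L + j) = key j"
    "reg s 15 = c * Suc (card ahead)" "reg s 16 = 0" "reg s 18 = c * Suc (card ahead) - B"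
    and Q: "\<And>k' s'. k' \<le> k + Suc n * (8 * n + 20) + 1 \<Longrightarrow> fixed_regs s' \<Longrightarrow>
      reg s' 16 \<le> lim \<longleftrightarrow> selectable weight_at lim ahead (Suc (card ahead) - B div c) 0 \<Longrightarrow> Q k' s'"
  shows "wp (WhileNZ 18 delete_body) Q k s"
proof -
  define A where "A = Suc (card ahead)"
  define N where "N = A - B div c"
  have A: "A \<le> Suc n" unfolding A_def ahead_def using card_mono[of "{..<n}" "{j. j < n \<and> score ip < rank j}"] by auto
  \<comment> \<open>The loop guard expresses the quotient bound without a division, so exactly
    \<open>N\<close> rounds are made.\<close>
  have over: "c * (A - j) - B \<noteq> 0 \<longleftrightarrow> j < N" for j
  proof -
    have "c * (A - j) \<le> B \<longleftrightarrow> A - j \<le> B div c"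
      using c by (simp add: less_eq_div_iff_mult_less_eq mult.commute)
    then show ?thesis by (auto simp: N_def)
  qed
  \<comment> \<open>\<open>S\<close> holds the candidates not yet deleted. The invariant claims only
    that the remaining question is equivalent to the original one, so it survives an exceeded limit
    and an exhausted \<open>S\<close>.\<close>
  define I where "I = (\<lambda>j k' s'. k' \<le> k + j * (8 * n + 20) \<and> fixed_regs s' \<and>
      reg s' 15 = c * (A - j) \<and> reg s' 18 = c * (A - j) - B \<and>
      (\<exists>S. S \<subseteq> {..<n} \<and> (\<forall>i<n. mem s' (L + i) = (if i \<in> S then Suc lim - weight_at i else 0)) \<and>
        (selectable weight_at lim S (N - j) (reg s' 16) \<longleftrightarrow> selectable weight_at lim ahead N 0)))"
  show ?thesis
  proof (rule wp_While[where N = N and I = I], goal_cases)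
    case 1
    have "ahead \<subseteq> {..<n}" by (auto simp: ahead_def)
    moreover have "\<forall>i<n. mem s (L + i) = (if i \<in> ahead then Suc lim - weight_at i else 0)"
      using assms(2) by (auto simp: key_def ahead_def)
    ultimately show ?case
      using assms(1,3,4,5) unfolding I_def A_def[symmetric] by auto
  next
    case (2 j k' s')
    from 2(2) obtain S where S: "S \<subseteq> {..<n}"
        "\<And>i. i < n \<Longrightarrow> mem s' (L + i) = (if i \<in> S then Suc lim - weight_at i else 0)"
        "selectable weight_at lim S (N - j) (reg s' 16) \<longleftrightarrow> selectable weight_at lim ahead N 0"
      unfolding I_def by blast
    have inv: "k' \<le> k + j * (8 * n + 20)" "fixed_regs s'" "reg s' 15 = c * (A - j)"
        "reg s' 18 = c * (A - j) - B"
      using 2(2) unfolding I_def by auto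
    note regs = inv(2)[unfolded fixed_regs_def]
    have "wp delete_body (I (Suc j)) (Suc k') s'"
      unfolding delete_body_def wp_Seq wp_Instr
    proof (rule wp_max_loop[where n = n and a = L], goal_cases)
      case (8 k2 s2 i)
      have mem2: "mem s2 = mem s'" using 8(2) by simp
      have max: "mem s' (L + i') \<le> mem s' (L + i)" if "i' < n" for i' using 8(7) that by simp
      have r13: "reg s2 13 = mem s' (L + i)" using 8(6) by simp
      have regs2: "reg s2 0 = L" "reg s2 (Suc 0) = n" "reg s2 2 = m" "reg s2 3 = B" "reg s2 4 = Suc lim"
        "reg s2 5 = tgt" "reg s2 6 = c" "reg s2 7 = 1" "reg s2 8 = Suc n" "reg s2 20 = 0"
        "reg s2 21 = 3" "reg s2 15 = c * (A - j)" "reg s2 16 = reg s' 16"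
        using 8(3) regs inv(3) by simp_all
      have Nj: "N - j = Suc (N - Suc j)" using 2(1) by simp
      have step: "selectable weight_at lim S (N - j) (reg s' 16) \<longleftrightarrow>
          selectable weight_at lim (S - {i}) (N - Suc j) (reg s' 16 + (Suc lim - mem s' (L + i)))"
      proof (cases "mem s' (L + i) = 0")
        case True
        \<comment> \<open>A largest key 0 means that no remaining candidate fits the limit. At least
          one deletion is still due, so the left side fails; the right side fails because
          \<open>Suc lim\<close> was added.\<close>
        have heavy: "lim < weight_at x" if "x \<in> S" for x
          using max[of x] S(1) S(2)[of x] that True by auto
        have "\<not> selectable weight_at lim S (N - j) (reg s' 16)"
        proof
          assume "selectable weight_at lim S (N - j) (reg s' 16)"
          then obtain D where D: "D \<subseteq> S" "card D = Suc (N - Suc j)" "reg s' 16 + sum weight_at D \<le> lim"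
            unfolding selectable_def Nj by blast
          then obtain x where x: "x \<in> D" by (metis card_Suc_eq insertI1)
          have "finite D" using D(2) card.infinite by fastforce
          then have "weight_at x \<le> sum weight_at D" using x by (intro member_le_sum) auto
          with heavy[of x] x D show False by auto
        qed
        then show ?thesis using True by (simp add: selectable_def)
      next
        case False
        then have i: "i \<in> S" "weight_at i \<le> lim" "Suc lim - mem s' (L + i) = weight_at i"
          using S(2)[OF 8(4)] by (auto split: if_splits)
        have "weight_at i \<le> weight_at x" if "x \<in> S" for x
          using max[of x] S(1,2) S(2)[of x] S(2)[OF 8(4)] that i by (auto simp: subset_iff)
        then show ?thesis
          using selectable_greedy[of S i weight_at lim "N - Suc j" "reg s' 16"] i S(1) Nj
            finite_subset by auto
      qed
      show ?case
        unfolding wp_Instr wp_Seq I_def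
      proof (intro conjI exI[of _ "S - {i}"], goal_cases)
        case 1
        then show ?case using 8(1) inv(1) by simp
      next
        case 2
        then show ?case using regs2 by (simp add: fixed_regs_def)
      next
        case 3
        then show ?case using regs2 by (simp add: diff_mult_distrib2)
      next
        case 4
        then show ?case using regs2 by (simp add: diff_mult_distrib2)
      next
        case 5
        then show ?case using S(1) by auto
      next
        case 6
        then show ?case using S(2) regs2 8(5) mem2 by simp
      next
        case 7
        then show ?case using step S(3) regs2 r13 by simp
      qed
    qed (use regs ip in simp_all)
    then show ?case using over[of j] inv(4) 2(1) by simp
  next
    case (3 k' s')
    from 3 obtain S where S: "selectable weight_at lim S 0 (reg s' 16) \<longleftrightarrow> selectable weight_at lim ahead N 0"
       "S \<subseteq> {..<n}"
      unfolding I_def by auto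
    have "selectable weight_at lim S 0 (reg s' 16) \<longleftrightarrow> reg s' 16 \<le> lim"
    proof -
      \<comment> \<open>Cardinality 0 alone would admit infinite sets; finiteness of
        \<open>S\<close> excludes them.\<close>
      have "D = {}" if "D \<subseteq> S" "card D = 0" for D
        using that S(2) finite_subset by (metis card_0_eq finite_lessThan)
      then show ?thesis unfolding selectable_def by (metis add.right_neutral card.empty empty_subsetI sum.empty)
    qed
    moreover have "N * (8 * n + 20) \<le> Suc n * (8 * n + 20)"
      using A unfolding N_def by (intro mult_le_mono1) simp
    ultimately show ?case using 3 Q[of "Suc k'" s'] S(1) over[of N] unfolding I_def N_def A_def by auto
  qed
qed

lemma wp_cc_prog:
  assumes "mem s = M" "reg s 0 = L"
    and Q: "\<And>k' s'. k' \<le> k + n * (5 * m + 20) + n * 20 + Suc n * (8 * n + 20) + 40 \<Longrightarrow>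
      accepting s' \<longleftrightarrow> selectable weight_at lim ahead (Suc (card ahead) - B div c) 0 \<Longrightarrow> Q k' s'"
  shows "wp cc_prog Q k s"
  unfolding cc_prog_def setup_prog_def wp_Seq wp_Instr
proof (rule wp_rank_loop, goal_cases)
  case (9 k1 s1)
  note 1 = this
  show ?case
    unfolding wp_Seq wp_Instr
  proof (rule wp_key_loop, goal_cases)
    case (8 k2 s2)
    note 2 = this
    show ?case
      unfolding wp_Seq wp_Instr
    proof (rule wp_delete_loop, goal_cases)
      case (6 k3 s3)
      show ?case unfolding wp_Instr
      proof (rule Q, goal_cases)
        case 1
        then show ?case using 6(1) 2(1) \<open>k1 \<le> _\<close> by simp
      next
        case 2
        \<comment> \<open>The final register 0 is \<open>Suc lim\<close> minus the spent weight,
          nonzero iff that weight is at most \<open>lim\<close>.\<close>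
        then show ?case using 6(2,3) by (auto simp: accepting_def fixed_regs_def)
      qed
    qed (use 2 in \<open>simp_all add: fixed_regs_def\<close>)
  qed (use 1 in \<open>simp_all add: fixed_regs_def\<close>)
qed (use assms(1,2) header in \<open>simp_all add: fixed_regs_def\<close>)

end

section \<open>GreedyAV with equal costs\<close>

text \<open>Once one project fails to fit, no later one fits, so skipping amounts to stopping and
  the output is a prefix.\<close>

lemma fold_greedy_step_same_cost:
  assumes "1 \<le> c" "finite W" "distinct qs" "set qs \<inter> W = {}"
    and "\<forall>q\<in>set qs \<union> W. cost E q = c" "card W \<le> budget E div c"
  shows "fold (greedy_step E) qs W = W \<union> set (take (budget E div c - card W) qs)"
  using assms(2-)
proof (induction qs arbitrary: W)
  case (Cons q qs)
  have fits: "total_cost E W + cost E q \<le> budget E \<longleftrightarrow> card W < budget E div c"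
  proof -
    have "total_cost E W + cost E q = Suc (card W) * c"
      using Cons.prems(4) by (simp add: total_cost_def)
    also have "\<dots> \<le> budget E \<longleftrightarrow> Suc (card W) \<le> budget E div c"
      using assms(1) by (simp add: less_eq_div_iff_mult_less_eq)
    finally show ?thesis by (simp add: Suc_le_eq)
  qed
  show ?case
  proof (cases "card W < budget E div c")
    case True
    have "q \<notin> W" using Cons.prems(3) by auto
    then have "fold (greedy_step E) qs (insert q W) =
        insert q W \<union> set (take (budget E div c - Suc (card W)) qs)"
      using Cons.IH[of "insert q W"] Cons.prems True by auto
    moreover have "budget E div c - card W = Suc (budget E div c - Suc (card W))"
      using True by simp
    ultimately show ?thesis using True fits by (simp add: greedy_step_def[of E q W])
  next
    case False
    then show ?thesis using Cons.IH[of W] Cons.prems fits by (auto simp: greedy_step_def[of E q W])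
  qed
qed simp

text \<open>The predecessors of \<open>p\<close> in the greedy order, described without sorting so
  that the effect of a deletion can be read off.\<close>

definition better :: "('p, 'v) pb \<Rightarrow> 'p \<Rightarrow> 'p set" where
  "better E p = {q \<in> projects E. score_AV E p < score_AV E q \<or>
     score_AV E q = score_AV E p \<and> q \<in> set (takeWhile (\<lambda>x. x \<noteq> p) (tie_order E))}"

lemma finite_better: "pb_instance E \<Longrightarrow> finite (better E p)"
  by (auto simp: better_def pb_instance_def)

text \<open>Sortedness places the projects whose score differs from that of \<open>p\<close>.
  Stability places the others: within that score class both orders coincide, so \<open>p\<close>
  cuts them at the same point.\<close>

lemma greedy_order_split:
  assumes "pb_instance E" "p \<in> projects E"
  obtains ys zs where "greedy_order E = ys @ p # zs" "set ys = better E p" "distinct (ys @ p # zs)"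
proof -
  let ?f = "\<lambda>q. - int (score_AV E q)"
  let ?tie = "\<lambda>q. score_AV E q = score_AV E p"
  have tie: "distinct (tie_order E)" "set (tie_order E) = projects E"
    using assms(1) by (auto simp: pb_instance_def)
  have order: "distinct (greedy_order E)" "set (greedy_order E) = projects E"
    using tie by (simp_all add: greedy_order_def)
  obtain ys zs where ys: "greedy_order E = ys @ p # zs"
    using assms(2) order(2) split_list by metis
  obtain as bs where as: "tie_order E = as @ p # bs"
    using assms(2) tie(2) split_list by metis
  have before: "set (takeWhile (\<lambda>x. x \<noteq> p) (tie_order E)) = set as"
    using tie(1) unfolding as by (subst takeWhile_append2) auto
  have sorted: "sorted (map ?f (ys @ p # zs))"
    unfolding ys[symmetric] greedy_order_def by simp
  have "filter ?tie (greedy_order E) = filter ?tie (tie_order E)"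
    using sort_key_stable[of ?f "?f p" "tie_order E"] by (simp add: greedy_order_def)
  then have "filter ?tie ys @ p # filter ?tie zs = filter ?tie as @ p # filter ?tie bs"
    by (simp add: ys as)
  moreover have "p \<notin> set ys" "p \<notin> set zs" "p \<notin> set as"
    using order(1) tie(1) unfolding ys as by auto
  ultimately have "filter ?tie ys = filter ?tie as"
    by (subst (asm) append_Cons_eq_iff) auto
  then have eq: "{q \<in> set ys. ?tie q} = {q \<in> set as. ?tie q}"
    by (metis set_filter)
  have ys_le: "\<forall>q\<in>set ys. score_AV E p \<le> score_AV E q" and zs_le: "\<forall>q\<in>set zs. score_AV E q \<le> score_AV E p"
    using sorted by (auto simp: sorted_append)
  have un: "projects E = set ys \<union> {p} \<union> set zs" using order(2) ys by auto
  have sub: "set as \<subseteq> projects E" using tie(2) as by auto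
  have "set ys = better E p"
    unfolding better_def before
  proof (intro equalityI subsetI)
    fix q assume q: "q \<in> set ys"
    then show "q \<in> {q \<in> projects E. score_AV E p < score_AV E q \<or> ?tie q \<and> q \<in> set as}"
      using ys_le un eq by (cases "?tie q") (auto simp: le_less)
  next
    fix q assume q: "q \<in> {q \<in> projects E. score_AV E p < score_AV E q \<or> ?tie q \<and> q \<in> set as}"
    show "q \<in> set ys"
    proof (cases "?tie q")
      case True
      then show ?thesis using q eq by auto
    next
      case False
      then show ?thesis using q un zs_le by force
    qed
  qed
  then show thesis using that ys order(1) by simp
qed

lemma greedyAV_iff_card_better:
  assumes "pb_instance E" "p \<in> projects E" "\<forall>q\<in>projects E. cost E q = c"
  shows "p \<in> greedyAV E \<longleftrightarrow> card (better E p) < budget E div c"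
proof -
  have c: "1 \<le> c" using assms by (auto simp: pb_instance_def)
  obtain ys zs where ys: "greedy_order E = ys @ p # zs" "set ys = better E p" "distinct (ys @ p # zs)"
    using greedy_order_split assms(1,2) .
  have "set (greedy_order E) = projects E"
    using assms(1) by (simp add: greedy_order_def pb_instance_def)
  then have "greedyAV E = set (take (budget E div c) (ys @ p # zs))"
    using fold_greedy_step_same_cost[OF c, of "{}" "greedy_order E" E] assms(3) ys
    by (simp add: greedyAV_def)
  also have "p \<in> \<dots> \<longleftrightarrow> length ys < budget E div c"
    using ys(3) by (cases "budget E div c - length ys") (auto dest: in_set_takeD)
  also have "length ys = card (better E p)"
    using ys(2,3) distinct_card[of ys] by simp
  finally show ?thesis .
qed

section \<open>Effect of deletions on the greedy order\<close>

lemma pb_instance_delete: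
  assumes "pb_instance E"
  shows "pb_instance (delete_projects D E)"
  using assms by (auto simp: pb_instance_def delete_projects_def)

lemma score_AV_delete: "q \<notin> D \<Longrightarrow> score_AV (delete_projects D E) q = score_AV E q"
  by (simp add: score_AV_def delete_projects_def)

lemma better_delete:
  assumes "p \<notin> D"
  shows "better (delete_projects D E) p = better E p - D"
proof -
  have "takeWhile (\<lambda>x. x \<noteq> p) (filter (\<lambda>q. q \<notin> D) xs) =
      filter (\<lambda>q. q \<notin> D) (takeWhile (\<lambda>x. x \<noteq> p) xs)" for xs
    using assms by (induction xs) auto
  moreover have "projects (delete_projects D E) = projects E - D"
      "tie_order (delete_projects D E) = filter (\<lambda>q. q \<notin> D) (tie_order E)"
    by (simp_all add: delete_projects_def)
  ultimately show ?thesis using assms by (auto simp: better_def score_AV_delete)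
qed

lemma greedyAV_delete_iff:
  assumes "pb_instance E" "p \<in> projects E - D" "\<forall>q\<in>projects E. cost E q = c"
  shows "p \<in> greedyAV (delete_projects D E) \<longleftrightarrow> card (better E p - D) < budget E div c"
proof -
  have "p \<in> greedyAV (delete_projects D E) \<longleftrightarrow>
      card (better (delete_projects D E) p) < budget (delete_projects D E) div c"
    using assms by (intro greedyAV_iff_card_better pb_instance_delete) (auto simp: delete_projects_def)
  then show ?thesis using assms(2) by (simp add: better_delete) (simp add: delete_projects_def)
qed

section \<open>The two control problems under equal costs\<close>

lemma same_cost_instancesD:
  assumes "I \<in> same_cost_instances" "p \<in> projects (election I)"
  shows "\<forall>q\<in>projects (election I). cost (election I) q = cost (election I) p"
  using assms unfolding same_cost_instances_def same_cost_def by blast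

lemma not_DC_yes:
  assumes "I \<in> DC_instances greedyAV \<inter> same_cost_instances"
  shows "\<not> DC_yes greedyAV I"
proof
  define E p where "E = election I" and "p = target I"
  have E: "pb_instance E" "p \<in> projects E" "p \<in> greedyAV E" "\<forall>q\<in>projects E. cost E q = cost E p"
    using assms same_cost_instancesD[of I p] unfolding DC_instances_def E_def p_def by blast+
  assume "DC_yes greedyAV I"
  then obtain D where D: "D \<subseteq> projects E - {p}" "p \<notin> greedyAV (delete_projects D E)"
    by (auto simp: DC_yes_def E_def p_def)
  have "card (better E p - D) \<le> card (better E p)"
    using finite_better[OF E(1)] by (intro card_mono) auto
  then show False
    using D E(2,3) greedyAV_iff_card_better[OF E(1,2,4)] greedyAV_delete_iff[OF E(1) _ E(4), where D = D]
    by (metis DiffI in_mono insertI1 Diff_iff le_less_trans)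
qed

lemma CC_yes_iff_selectable:
  fixes I :: "('p, 'v) control"
  assumes "I \<in> CC_instances greedyAV \<inter> same_cost_instances"
  defines "E \<equiv> election I" and "p \<equiv> target I"
  shows "CC_yes greedyAV I \<longleftrightarrow> selectable (weight I) (limit I) (better E p)
    (Suc (card (better E p)) - budget E div cost E p) 0"
proof -
  have E: "pb_instance E" "p \<in> projects E" "p \<notin> greedyAV E" "\<forall>q\<in>projects E. cost E q = cost E p"
    using assms same_cost_instancesD[of I p] unfolding CC_instances_def E_def p_def by blast+
  define K where "K = budget E div cost E p"
  \<comment> \<open>A single project fits the budget, so removing all predecessors is always
    enough.\<close>
  have K: "1 \<le> K" using E(1,2) by (auto simp: K_def pb_instance_def div_greater_zero_iff Suc_le_eq)
  note fin = finite_better[OF E(1), of p]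
  have sub: "better E p \<subseteq> projects E - {p}"
    by (auto simp: better_def dest: set_takeWhileD)
  have "p \<in> greedyAV (delete_projects D E) \<longleftrightarrow> card (better E p - D) < K"
    if "D \<subseteq> projects E - {p}" for D
    using greedyAV_delete_iff[OF E(1) _ E(4), where D = D] E(2) that unfolding K_def by blast
  then have yes: "CC_yes greedyAV I \<longleftrightarrow> (\<exists>D. D \<subseteq> projects E - {p} \<and>
      sum (weight I) D \<le> limit I \<and> card (better E p - D) < K)"
    unfolding CC_yes_def E_def[symmetric] p_def[symmetric] by blast
  show ?thesis unfolding yes K_def[symmetric]
  proof
    assume "\<exists>D. D \<subseteq> projects E - {p} \<and> sum (weight I) D \<le> limit I \<and> card (better E p - D) < K"
    then obtain D where D: "D \<subseteq> projects E - {p}" "sum (weight I) D \<le> limit I"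
      "card (better E p - D) < K" by blast
    have "finite D" using D(1) E(1) finite_subset by (auto simp: pb_instance_def)
    have "card (better E p - D) = card (better E p) - card (better E p \<inter> D)"
      using fin by (simp add: card_Diff_subset_Int)
    then have "Suc (card (better E p)) - K \<le> card (better E p \<inter> D)" using D(3) by linarith
    then obtain D' where D': "D' \<subseteq> better E p \<inter> D" "card D' = Suc (card (better E p)) - K"
      by (meson obtain_subset_with_card_n)
    have "sum (weight I) D' \<le> sum (weight I) D" using D' \<open>finite D\<close> by (intro sum_mono2) auto
    then show "selectable (weight I) (limit I) (better E p) (Suc (card (better E p)) - K) 0"
      using D' D(2) unfolding selectable_def by (intro exI[of _ D']) auto
  next
    assume "selectable (weight I) (limit I) (better E p) (Suc (card (better E p)) - K) 0"
    then obtain D where D: "D \<subseteq> better E p" "card D = Suc (card (better E p)) - K"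
      "sum (weight I) D \<le> limit I" by (auto simp: selectable_def)
    have "card (better E p - D) = card (better E p) - card D"
      using D(1) fin finite_subset by (intro card_Diff_subset) auto
    then have "card (better E p - D) < K" using D(2) K by linarith
    then show "\<exists>D. D \<subseteq> projects E - {p} \<and> sum (weight I) D \<le> limit I \<and> card (better E p - D) < K"
      using D sub by blast
  qed
qed

section \<open>Running the program on encoded instances\<close>

text \<open>Carries the selection problem from list positions, which the program handles, to
  projects.\<close>

lemma selectable_image:
  assumes "inj_on f S" "\<And>x. x \<in> S \<Longrightarrow> w (f x) = w' x"
  shows "selectable w r (f ` S) d acc \<longleftrightarrow> selectable w' r S d acc"
proof -
  have "card (f ` D) = card D \<and> sum w (f ` D) = sum w' D" if "D \<subseteq> S" for D
    using inj_on_subset[OF assms(1) that] that assms(2)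
    by (auto simp: card_image sum.reindex intro!: sum.cong)
  then show ?thesis unfolding selectable_def
    by (metis (no_types, lifting) image_mono subset_image_iff)
qed

lemma nth_concat_map:
  assumes "\<And>x. length (f x) = k" "i < length xs" "j < k"
  shows "concat (map f xs) ! (i * k + j) = f (xs ! i) ! j"
  using assms(2)
proof (induction xs arbitrary: i)
  case (Cons x xs)
  then show ?case using assms(1,3) by (cases i) (auto simp: nth_append)
qed simp

lemma length_concat_map:
  assumes "\<And>x. length (f x) = k"
  shows "length (concat (map f xs)) = length xs * k"
  using assms by (induction xs) auto

context
  fixes I :: "(nat, nat) control" and E qs vs
  assumes I: "pb_instance (election I)"
  defines "E \<equiv> election I"
  defines "qs \<equiv> tie_order E" and "vs \<equiv> sorted_list_of_set (voters E)"
begin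

lemma encode_eq: "encode I = [length qs, length vs, budget E, limit I, target I]
     @ concat (map (\<lambda>q. [q, cost E q, weight I q]) qs)
     @ concat (map (\<lambda>v. v # map (\<lambda>q. of_bool (q \<in> approves E v)) qs) vs)"
  by (simp add: encode_def Let_def E_def qs_def vs_def)

lemma length_encode: "length (encode I) = 5 + 3 * length qs + length vs * Suc (length qs)"
  using length_concat_map[of "\<lambda>q. [q, cost E q, weight I q]" 3 qs]
    length_concat_map[of "\<lambda>v. v # map (\<lambda>q. of_bool (q \<in> approves E v) :: nat) qs" "Suc (length qs)" vs]
  by (simp add: encode_eq)

lemma nth_encode_header:
  "encode I ! 0 = length qs" "encode I ! 1 = length vs" "encode I ! 2 = budget E"
  "encode I ! 3 = limit I" "encode I ! 4 = target I"
  by (simp_all add: encode_eq numeral_eq_Suc)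

lemma nth_encode_project:
  assumes "j < length qs" "i < 3"
  shows "encode I ! (5 + 3 * j + i) = [qs ! j, cost E (qs ! j), weight I (qs ! j)] ! i"
proof -
  have "3 * j + i < length (concat (map (\<lambda>q. [q, cost E q, weight I q]) qs))"
    using length_concat_map[of "\<lambda>q. [q, cost E q, weight I q]" 3 qs] assms by simp
  then show ?thesis
    using nth_concat_map[of "\<lambda>q. [q, cost E q, weight I q]" 3 j qs i] assms
    by (simp add: encode_eq nth_append mult.commute)
qed

lemma nth_encode_vote:
  assumes "j < length qs" "v < length vs"
  shows "encode I ! (6 + 3 * length qs + j + v * Suc (length qs)) =
    of_bool (qs ! j \<in> approves E (vs ! v))"
proof -
  let ?ps = "concat (map (\<lambda>q. [q, cost E q, weight I q]) qs)"
  have "length ?ps = 3 * length qs"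
    using length_concat_map[of "\<lambda>q. [q, cost E q, weight I q]" 3 qs] by simp
  \<comment> \<open>Project \<open>j\<close> is entry \<open>Suc j\<close> of a ballot, since entry
    0 is the voter's name.\<close>
  then show ?thesis
    using nth_concat_map[of "\<lambda>v. v # map (\<lambda>q. of_bool (q \<in> approves E v) :: nat) qs"
        "Suc (length qs)" v vs "Suc j"] assms
    by (simp add: encode_eq nth_append algebra_simps)
qed

end

lemma takeWhile_neq_nth:
  assumes "distinct xs" "i < length xs"
  shows "takeWhile (\<lambda>x. x \<noteq> xs ! i) xs = take i xs"
  using assms by (intro takeWhile_eq_take_P_nth) (auto simp: nth_eq_iff_index_eq)

lemma cc_prog_correct:
  assumes "I \<in> CC_instances greedyAV \<inter> same_cost_instances"
  defines "x \<equiv> input_len (encode I)"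
  shows "wp cc_prog (\<lambda>k s. k \<le> 200 * (x + 1)\<^sup>2 \<and> (accepting s \<longleftrightarrow> CC_yes greedyAV I)) 0
    (init_state (encode I))"
proof -
  define E p where "E = election I" and "p = target I"
  have E: "pb_instance E" "p \<in> projects E" "\<forall>q\<in>projects E. cost E q = cost E p"
    using assms same_cost_instancesD[of I p] unfolding CC_instances_def E_def p_def by blast+
  define qs vs where "qs = tie_order E" and "vs = sorted_list_of_set (voters E)"
  have qs: "distinct qs" "set qs = projects E" using E(1) by (auto simp: pb_instance_def qs_def)
  have vs: "distinct vs" "set vs = voters E" using E(1) by (auto simp: pb_instance_def vs_def)
  define n m L where "n = length qs" and "m = length vs" and "L = length (encode I)"
  define M where "M = (\<lambda>i. if i < L then encode I ! i else 0)"
  have pb: "pb_instance (election I)" using E(1) by (simp add: E_def)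
  note folds = E_def[symmetric] qs_def[symmetric] vs_def[symmetric] n_def[symmetric]
    m_def[symmetric] p_def[symmetric] L_def[symmetric]
  have L: "L = 5 + 3 * n + m * Suc n"
    using length_encode[OF pb, unfolded folds] .
  obtain ip where idx: "ip < n" "qs ! ip = p"
    using E(2)[folded qs(2)] unfolding n_def by (metis in_set_conv_nth)
  have project: "M (5 + 3 * j) = qs ! j" "M (6 + 3 * j) = cost E (qs ! j)"
    "M (7 + 3 * j) = weight I (qs ! j)" if "j < n" for j
    using nth_encode_project[OF pb, unfolded folds, OF that, of 0]
      nth_encode_project[OF pb, unfolded folds, OF that, of 1]
      nth_encode_project[OF pb, unfolded folds, OF that, of 2] that
    by (simp_all add: M_def L numeral_2_eq_2)
  have cost0: "cost E (qs ! 0) = cost E p"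
    using bspec[OF E(3)] nth_mem[of 0 qs] qs(2) idx(1) unfolding n_def by (metis gr_zeroI less_nat_zero_code)
  interpret cc_data M n m L "budget E" "limit I" p "cost E p" ip
  proof
    show "L = 5 + 3 * n + m * Suc n" by (fact L)
    show "M 0 = n" "M 1 = m" "M 2 = budget E" "M 3 = limit I" "M 4 = p"
      using nth_encode_header[OF pb, unfolded folds] by (simp_all add: M_def L)
    show "M 6 = cost E p" using project(2)[of 0] idx(1) cost0 by simp
    show "ip < n" by (fact idx)
    show "M (5 + 3 * j) = p \<longleftrightarrow> j = ip" if "j < n" for j
      using project(1)[OF that] that idx qs(1) by (auto simp: n_def nth_eq_iff_index_eq)
    show "1 \<le> cost E p" using E(1,2) by (auto simp: pb_instance_def)
  qed
  have score: "score j = score_AV E (qs ! j)" if "j < n" for j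
  proof -
    have "score j = (\<Sum>v<m. of_bool (qs ! j \<in> approves E (vs ! v)))"
      unfolding score_def
    proof (intro sum.cong refl)
      fix v assume "v \<in> {..<m}"
      then show "M (6 + 3 * n + j + v * Suc n) = of_bool (qs ! j \<in> approves E (vs ! v))"
        using nth_encode_vote[OF pb, unfolded folds, OF that, of v] vote_below[OF that, of v]
        by (simp add: M_def)
    qed
    also have "\<dots> = (\<Sum>v\<in>voters E. of_bool (qs ! j \<in> approves E v))"
      using vs bij_betw_nth[of vs "{..<m}" "voters E"]
      by (intro sum.reindex_bij_betw) (auto simp: m_def)
    also have "\<dots> = score_AV E (qs ! j)"
      using E(1) by (simp add: score_AV_def pb_instance_def sum.If_cases of_bool_def Int_def conj_commute)
    finally show ?thesis .
  qed
  have ahead: "(\<lambda>j. qs ! j) ` ahead = better E p"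
  proof -
    have "set (takeWhile (\<lambda>x. x \<noteq> p) (tie_order E)) = (\<lambda>j. qs ! j) ` {..<ip}"
      using takeWhile_neq_nth[OF qs(1), of ip] idx nth_image[of ip qs]
      by (simp add: n_def qs_def[symmetric] atLeast0LessThan)
    then have prec: "qs ! j \<in> set (takeWhile (\<lambda>x. x \<noteq> p) (tie_order E)) \<longleftrightarrow> j < ip" if "j < n" for j
      using that idx(1) qs(1) by (auto simp: n_def nth_eq_iff_index_eq)
    \<comment> \<open>Scores are integers, so a bonus of 1 matters only at equality: comparing ranks
      is the lexicographic comparison by score and tie-breaking.\<close>
    have "score ip < rank j \<longleftrightarrow> qs ! j \<in> better E p" if "j < n" for j
    proof -
      have "qs ! j \<in> projects E" using that qs(2) nth_mem[of j qs] by (simp add: n_def)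
      then show ?thesis
        unfolding better_def rank_def score[OF that] score[OF idx(1)] idx(2)
        using prec[OF that] by auto
    qed
    then have "ahead = {j. j < n \<and> qs ! j \<in> better E p}" by (auto simp: ahead_def)
    moreover have "better E p \<subseteq> set qs" using qs(2) by (auto simp: better_def)
    ultimately show ?thesis by (auto simp: n_def in_set_conv_nth subset_iff)
  qed
  have inj: "inj_on (\<lambda>j. qs ! j) ahead"
    by (intro inj_on_nth[OF qs(1)]) (auto simp: ahead_def n_def[symmetric])
  have sel: "selectable weight_at (limit I) ahead (Suc (card ahead) - budget E div cost E p) 0 \<longleftrightarrow>
      CC_yes greedyAV I"
  proof -
    have "weight I (qs ! j) = weight_at j" if "j \<in> ahead" for j
      using that project(3)[of j] by (simp add: ahead_def weight_at_def)
    then show ?thesis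
      using CC_yes_iff_selectable[OF assms(1), unfolded folds] selectable_image[OF inj, of "weight I" weight_at]
        card_image[OF inj] by (simp add: ahead)
  qed
  show ?thesis
  proof (rule wp_cc_prog, goal_cases)
    case (3 k s)
    have "L \<le> x" by (simp add: L_def x_def length_le_input_len)
    then have le: "n \<le> x" "m \<le> x" using L by (auto intro: order.trans[of m "m * Suc n"])
    have "n * (5 * m + 20) \<le> x * (5 * x + 20)"
      by (intro mult_le_mono) (use le in simp_all)
    moreover have "Suc n * (8 * n + 20) \<le> Suc x * (8 * x + 20)"
      by (intro mult_le_mono) (use le in simp_all)
    ultimately have "k \<le> x * (5 * x + 20) + x * 20 + Suc x * (8 * x + 20) + 40"
      using 3(1) le by linarith
    \<comment> \<open>The left side is 13 x^2 + 68 x + 60, so 200 is generous.\<close>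
    also have "\<dots> \<le> 200 * (x + 1)\<^sup>2" by (simp add: power2_eq_square algebra_simps)
    finally show ?case using 3(2) sel by simp
  qed (auto simp: init_state_def M_def L_def)
qed

theorem proposition1:
  "poly_time_solvable encode (CC_instances greedyAV \<inter> same_cost_instances) (CC_yes greedyAV) \<and>
   poly_time_solvable encode (DC_instances greedyAV \<inter> same_cost_instances) (DC_yes greedyAV)"
proof
  define T :: "nat poly" where "T = [:200:] * [:1, 1:]\<^sup>2"
  \<comment> \<open>With \<open>T\<close> bounding the steps, this is the logarithmic cost bound at
    \<open>u = x + T x\<close>.\<close>
  define b :: "nat poly" where "b = T * ([:2:] * ([:1, 1:] + T))"
  have T: "poly T x = 200 * (x + 1)\<^sup>2" for x by (simp add: T_def)
  have b: "poly b x = poly T x * (2 * Suc (x + poly T x))" for x by (simp add: b_def)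
  show "poly_time_solvable encode (CC_instances greedyAV \<inter> same_cost_instances) (CC_yes greedyAV)"
    unfolding poly_time_solvable_def
  proof (rule exI[of _ cc_prog], rule exI[of _ b], rule ballI)
    fix I :: "(nat, nat) control" assume I: "I \<in> CC_instances greedyAV \<inter> same_cost_instances"
    define x where "x = input_len (encode I)"
    obtain k s where k: "run cc_prog (init_state (encode I)) k s" "k \<le> poly T x"
        "accepting s \<longleftrightarrow> CC_yes greedyAV I"
      using cc_prog_correct[OF I] by (auto simp: wp_def T x_def)
    \<comment> \<open>The five header cells alone give \<open>2 ^ x\<close> at least 32, above every
      constant of the program; the largest is 7.\<close>
    have "5 \<le> length (encode I)" by (simp add: encode_def Let_def)
    then have "5 \<le> x" unfolding x_def using length_le_input_len order.trans by blast
    then have "(2::nat) ^ 5 \<le> 2 ^ x" by (intro power_increasing) auto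
    then have "\<forall>a\<in>consts_of cc_prog. a < 2 ^ x"
      by (simp add: cc_prog_def setup_prog_def rank_body_def score_loop_def key_body_def
          delete_body_def max_loop_def)
    then obtain t where t: "exec cc_prog (init_state (encode I)) t s" "t \<le> k * (2 * Suc (x + k))"
      using run_imp_exec[OF k(1) bits_bounded_init, of "x + k"] unfolding x_def by auto
    have "k * (2 * Suc (x + k)) \<le> poly b x"
      unfolding b using k(2) by (intro mult_le_mono) auto
    with t k(3) show "\<exists>t s. exec cc_prog (init_state (encode I)) t s \<and>
        t \<le> poly b (input_len (encode I)) \<and> (accepting s \<longleftrightarrow> CC_yes greedyAV I)"
      unfolding x_def by (meson order.trans)
  qed
  show "poly_time_solvable encode (DC_instances greedyAV \<inter> same_cost_instances) (DC_yes greedyAV)"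
    unfolding poly_time_solvable_def
  proof (rule exI[of _ "Instr (SetC 0 0)"], rule exI[of _ 1], rule ballI)
    fix I :: "(nat, nat) control" assume I: "I \<in> DC_instances greedyAV \<inter> same_cost_instances"
    have "exec (Instr (SetC 0 0)) s 1 (instr_effect (SetC 0 0) s)" for s
      using exec_Instr[of "SetC 0 0" s] by (simp add: nat_len_def floorlog_def)
    then show "\<exists>t s. exec (Instr (SetC 0 0)) (init_state (encode I)) t s \<and>
        t \<le> poly 1 (input_len (encode I)) \<and> (accepting s \<longleftrightarrow> DC_yes greedyAV I)"
      using not_DC_yes[OF I]
      by (intro exI[of _ 1] exI[of _ "instr_effect (SetC 0 0) (init_state (encode I))"])
        (simp add: accepting_def)
  qed
qed

end
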